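(* Let $G=(V,E)$ be a finite complete graph with probability weights $p_G=(p_x)_{x\in E\cup V}\in[0,1]^{E\cup V}$. Let $v,w\in V$ be such that $p_{vu}=p_{wu}$ for all $u\in V\setminus\{v,w\}$. Then $$\mathbb{P}_{p_G}(v_-\leftrightarrow w_-)\ \ge\ \mathbb{P}_{p_G}(v_-\leftrightarrow w_+).$$
   Context: All graphs are simple and undirected; $uv$ denotes the edge $\{u,v\}$. For a finite graph $G=(V,E)$ the bunkbed graph $G^\pm=(V^\pm,E^\pm)$ has vertex set $V^\pm:=V\times\{+,-\}$, where we write $v_+:=(v,+)$ and $v_-:=(v,-)$, and edge set $E^\pm:=\{u_+v_+,\,u_-v_-: uv\in E\}\cup\{u_+u_-: u\in V\}$. Given weights $p_G=(p_x)_{x\in E\cup V}\in[0,1]^{E\cup V}$ (one weight $p_{uv}$ per edge $uv\in E$ and one weight $p_u$ per vertex $u\in V$), define edge probabilities on $G^\pm$ by $p_{u_+v_+}=p_{u_-v_-}:=p_{uv}$ for $uv\in E$ and $p_{u_+u_-}:=p_u$ for $u\in V$. Independent bond percolation: let $(\mathcal{Z}_e)_{e\in E^\pm}$ be independent $\{0,1\}$-valued random variables with $\mathbb{P}_{p_G}(\mathcal{Z}_e=1)=p_e$; the edge $e$ is open if $\mathcal{Z}_e=1$ and closed if $\mathcal{Z}_e=0$. For $x,y\in V^\pm$, $x\leftrightarrow y$ is the event that $x$ and $y$ are joined by a (possibly trivial) path of finitely many open edges of $G^\pm$. *)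

theory Defs
  imports "HOL-Probability.Probability"
begin

text \<open>A graph is a pair of a vertex set and an edge set; an edge is a two-element set of vertices.\<close>

definition simple_graph :: "'a set \<Rightarrow> 'a set set \<Rightarrow> bool" where
  "simple_graph V E \<longleftrightarrow> (\<forall>e\<in>E. \<exists>u\<in>V. \<exists>v\<in>V. u \<noteq> v \<and> e = {u, v})"

definition complete_graph :: "'a set \<Rightarrow> 'a set set \<Rightarrow> bool" where
  "complete_graph V E \<longleftrightarrow> simple_graph V E \<and> (\<forall>u\<in>V. \<forall>v\<in>V. u \<noteq> v \<longrightarrow> {u, v} \<in> E)"

datatype layer = Plus | Minus

definition bunkbed_verts :: "'a set \<Rightarrow> ('a \<times> layer) set" where
  "bunkbed_verts V = V \<times> {Plus, Minus}"

definition bunkbed_edges :: "'a set \<Rightarrow> 'a set set \<Rightarrow> ('a \<times> layer) set set" where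
  "bunkbed_edges V E =
     {{(u, Plus), (v, Plus)} | u v. {u, v} \<in> E} \<union>
     {{(u, Minus), (v, Minus)} | u v. {u, v} \<in> E} \<union>
     {{(u, Plus), (u, Minus)} | u. u \<in> V}"

text \<open>
  The weights on \<open>E \<union> V\<close> are split into \<open>pE\<close> on the edges and \<open>pV\<close> on the vertices.
  Projecting a vertical edge of the bunkbed graph to its first components gives a singleton \<open>{u}\<close>,
  whereas a horizontal edge is projected to the edge of \<open>E\<close> that it copies.
\<close>

definition bunkbed_weight :: "('a set \<Rightarrow> real) \<Rightarrow> ('a \<Rightarrow> real) \<Rightarrow> ('a \<times> layer) set \<Rightarrow> real" where
  "bunkbed_weight pE pV e = (if is_singleton (fst ` e) then pV (the_elem (fst ` e)) else pE (fst ` e))"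

lemma bunkbed_weight_vertical: "bunkbed_weight pE pV {(u, Plus), (u, Minus)} = pV u"
  by (simp add: bunkbed_weight_def)

lemma bunkbed_weight_horizontal:
  assumes "u \<noteq> v"
  shows "bunkbed_weight pE pV {(u, s), (v, s)} = pE {u, v}"
proof -
  have "\<not> is_singleton {u, v}"
    using assms by (auto simp: is_singleton_def)
  then show ?thesis by (simp add: bunkbed_weight_def)
qed

text \<open>
  Configurations map each edge to whether it is open. The edges are open independently of each other;
  outside the (finite) edge set a configuration has the dummy value \<open>False\<close>.
\<close>

definition percolation ::
  "'a set \<Rightarrow> 'a set set \<Rightarrow> ('a set \<Rightarrow> real) \<Rightarrow> ('a \<Rightarrow> real) \<Rightarrow> (('a \<times> layer) set \<Rightarrow> bool) pmf" where
  "percolation V E pE pV =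
     Pi_pmf (bunkbed_edges V E) False (\<lambda>e. bernoulli_pmf (bunkbed_weight pE pV e))"

lemma finite_bunkbed_edges:
  assumes "finite V" "simple_graph V E"
  shows "finite (bunkbed_edges V E)"
proof (rule finite_subset)
  show "bunkbed_edges V E \<subseteq> Pow (bunkbed_verts V)"
    using assms(2)
    by (fastforce simp: bunkbed_edges_def bunkbed_verts_def simple_graph_def doubleton_eq_iff)
  show "finite (Pow (bunkbed_verts V))"
    using assms(1) by (simp add: bunkbed_verts_def)
qed

lemma indep_vars_percolation:
  assumes "finite V" "simple_graph V E"
  shows "prob_space.indep_vars (measure_pmf (percolation V E pE pV)) (\<lambda>_. count_space UNIV)
           (\<lambda>e \<omega>. \<omega> e) (bunkbed_edges V E)"
  unfolding percolation_def using finite_bunkbed_edges[OF assms] by (rule indep_vars_Pi_pmf)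

lemma prob_open_edge:
  assumes "finite V" "simple_graph V E" "e \<in> bunkbed_edges V E"
    and "bunkbed_weight pE pV e \<in> {0..1}"
  shows "measure_pmf.prob (percolation V E pE pV) {\<omega>. \<omega> e} = bunkbed_weight pE pV e"
proof -
  have "map_pmf (\<lambda>\<omega>. \<omega> e) (percolation V E pE pV) = bernoulli_pmf (bunkbed_weight pE pV e)"
    using assms(3) finite_bunkbed_edges[OF assms(1,2)]
    by (simp add: percolation_def Pi_pmf_component)
  then have "pmf (map_pmf (\<lambda>\<omega>. \<omega> e) (percolation V E pE pV)) True = bunkbed_weight pE pV e"
    using assms(4) by simp
  then show ?thesis
    by (simp add: pmf_map vimage_def)
qed

definition open_path ::
  "'a set \<Rightarrow> 'a set set \<Rightarrow> (('a \<times> layer) set \<Rightarrow> bool) \<Rightarrow> ('a \<times> layer) list \<Rightarrow> bool" where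
  "open_path V E \<omega> xs \<longleftrightarrow> xs \<noteq> [] \<and> distinct xs \<and> set xs \<subseteq> bunkbed_verts V \<and>
     successively (\<lambda>a b. {a, b} \<in> bunkbed_edges V E \<and> \<omega> {a, b}) xs"

definition joined ::
  "'a set \<Rightarrow> 'a set set \<Rightarrow> (('a \<times> layer) set \<Rightarrow> bool) \<Rightarrow> 'a \<times> layer \<Rightarrow> 'a \<times> layer \<Rightarrow> bool" where
  "joined V E \<omega> x y \<longleftrightarrow> (\<exists>xs. open_path V E \<omega> xs \<and> hd xs = x \<and> last xs = y)"

end

theory Submission
  imports Defs
begin

text \<open>
  If \<open>v = w\<close>, the left-hand side is \<open>1\<close>. Otherwise write \<open>y1, y2, y3, y4\<close> for
  \<open>v\<^sub>-, w\<^sub>-, v\<^sub>+, w\<^sub>+\<close>. Exchanging the two layers preserves the measure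
  (\<open>prob_reachable_reflect\<close>), so the claim is equivalent to
  \<open>P(y1 \<leftrightarrow> y4) + P(y2 \<leftrightarrow> y3) \<le> P(y1 \<leftrightarrow> y2) + P(y3 \<leftrightarrow> y4)\<close>.
  This holds in every finite graph in which \<open>y1, y2\<close> are twins and \<open>y3, y4\<close> are twins with respect to
  the remaining vertices, and \<open>y1 y4\<close> and \<open>y2 y3\<close> are not edges (\<open>twin_pairs_connection\<close>).

  A pair of terminals is called isolated if its two members are connected to each other but to no other
  terminal. Since connectedness is an equivalence relation, each of the four connection events may be
  replaced by the event that the pair is isolated: the other contributions cancel
  (\<open>isolated_pairs_decomposition\<close>). Now fix the state of all edges except those between a terminal and
  a non-terminal. If some edge between two different terminals is open, the pairs \<open>y1, y4\<close> and
  \<open>y2, y3\<close> cannot be isolated. Otherwise consider the open clusters \<open>C\<close> of the non-terminals. By the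
  twin property, each of \<open>y1, y2\<close> misses \<open>C\<close> with some probability \<open>a C\<close> and each of \<open>y3, y4\<close> with
  some probability \<open>b C\<close>, all independently. A pair is isolated iff no cluster is touched both from the
  pair and from the other two terminals, and some cluster is touched by both members of the pair. Hence
  its probability is a difference of two products over the clusters (\<open>prob_isolated_pair\<close>).

  Per cluster, the factors of these products are related by \<open>g = \<alpha>\<^sup>2 + h1\<close> for \<open>y1, y2\<close>,
  \<open>g = \<beta>\<^sup>2 + h2\<close> for \<open>y3, y4\<close> and \<open>g = \<alpha> \<beta> + h\<close> for both mixed pairs, where
  \<open>\<alpha> = (1 - a) b\<close>, \<open>\<beta> = (1 - b) a\<close> and \<open>h\<^sup>2 \<le> h1 h2\<close>. Expanding the products over the nonempty
  sets of clusters and applying the inequality between arithmetic and geometric mean to each term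
  (\<open>twin_product_inequality\<close>) finishes the proof.
\<close>

section \<open>An inequality between products\<close>

lemma two_mult_le_sum_of_sqrt_bound:
  fixes A B P Q M :: real
  assumes "0 \<le> A" "0 \<le> B" "0 \<le> P" "0 \<le> Q" "0 \<le> M" "M\<^sup>2 \<le> P * Q"
  shows "2 * (A * B * M) \<le> A\<^sup>2 * P + B\<^sup>2 * Q"
proof -
  have "M \<le> sqrt P * sqrt Q"
    using assms by (metis real_le_rsqrt real_sqrt_mult)
  then have "2 * (A * B * M) \<le> 2 * (A * B * (sqrt P * sqrt Q))"
    using assms by (intro mult_left_mono) auto
  also have "\<dots> = 2 * (A * sqrt P) * (B * sqrt Q)" by simp
  also have "\<dots> \<le> (A * sqrt P)\<^sup>2 + (B * sqrt Q)\<^sup>2" by (rule sum_squares_bound)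
  also have "\<dots> = A\<^sup>2 * P + B\<^sup>2 * Q" using assms by (simp add: power_mult_distrib)
  finally show ?thesis .
qed

lemma prod_increment_AM_GM:
  fixes \<alpha> \<beta> h1 h2 h :: "'i \<Rightarrow> real"
  assumes fin: "finite I"
    and nonneg: "\<And>i. i \<in> I \<Longrightarrow> 0 \<le> \<alpha> i \<and> 0 \<le> \<beta> i \<and> 0 \<le> h1 i \<and> 0 \<le> h2 i \<and> 0 \<le> h i"
    and le: "\<And>i. i \<in> I \<Longrightarrow> (h i)\<^sup>2 \<le> h1 i * h2 i"
  shows "2 * ((\<Prod>i\<in>I. \<alpha> i * \<beta> i + h i) - prod h I)
      \<le> ((\<Prod>i\<in>I. (\<alpha> i)\<^sup>2 + h1 i) - prod h1 I) + ((\<Prod>i\<in>I. (\<beta> i)\<^sup>2 + h2 i) - prod h2 I)"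
proof -
  \<comment> \<open>Subtracting \<open>prod y I\<close> removes the term of the empty set from the expansion.\<close>
  have expand: "(\<Prod>i\<in>I. x i + y i) - prod y I = (\<Sum>X\<in>Pow I - {{}}. prod x X * prod y (I - X))"
    for x y :: "'i \<Rightarrow> real"
    using fin by (subst prod_add) (simp_all add: sum.remove[of "Pow I" "{}"])
  have term_le: "2 * (prod (\<lambda>i. \<alpha> i * \<beta> i) X * prod h (I - X))
      \<le> prod (\<lambda>i. (\<alpha> i)\<^sup>2) X * prod h1 (I - X) + prod (\<lambda>i. (\<beta> i)\<^sup>2) X * prod h2 (I - X)"
    if "X \<subseteq> I" for X
  proof -
    have "(prod h (I - X))\<^sup>2 \<le> prod h1 (I - X) * prod h2 (I - X)"
      unfolding prod_power_distrib prod.distrib[symmetric] using le by (intro prod_mono) auto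
    then show ?thesis
      using two_mult_le_sum_of_sqrt_bound[of "prod \<alpha> X" "prod \<beta> X" "prod h1 (I - X)"
          "prod h2 (I - X)" "prod h (I - X)"] nonneg that
      by (auto simp: prod.distrib prod_power_distrib intro!: prod_nonneg)
  qed
  show ?thesis
    unfolding expand sum_distrib_left sum.distrib[symmetric]
    by (intro sum_mono term_le) auto
qed

text \<open>
  If four terminals miss a cluster independently with probabilities \<open>x, y, z, t\<close>, then \<open>g x y z t\<close> is the
  probability that the cluster is not touched both from the first two and from the last two, and
  \<open>h x y z t\<close> the probability that in addition it is not touched by both of the first two.
\<close>

lemma twin_product_inequality:
  fixes a b :: "'i \<Rightarrow> real"
  assumes fin: "finite I" and a: "\<And>i. i \<in> I \<Longrightarrow> a i \<in> {0..1}" and b: "\<And>i. i \<in> I \<Longrightarrow> b i \<in> {0..1}"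
  defines "g \<equiv> \<lambda>x y z t. x * y + z * t - x * y * z * t :: real"
    and "h \<equiv> \<lambda>x y z t. x * y + x * z * t + y * z * t - 2 * (x * y * z * t) :: real"
  shows "2 * ((\<Prod>i\<in>I. g (a i) (b i) (b i) (a i)) - (\<Prod>i\<in>I. h (a i) (b i) (b i) (a i)))
      \<le> ((\<Prod>i\<in>I. g (a i) (a i) (b i) (b i)) - (\<Prod>i\<in>I. h (a i) (a i) (b i) (b i)))
       + ((\<Prod>i\<in>I. g (b i) (b i) (a i) (a i)) - (\<Prod>i\<in>I. h (b i) (b i) (a i) (a i)))"
proof -
  have gh: "g x y y x = ((1 - x) * y) * ((1 - y) * x) + h x y y x"
    "g x x y y = ((1 - x) * y)\<^sup>2 + h x x y y" "g y y x x = ((1 - y) * x)\<^sup>2 + h y y x x" for x y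
    by (simp_all add: g_def h_def power2_eq_square algebra_simps)
  have nonneg: "0 \<le> h x y z t"
    if "x \<in> {0..1}" "y \<in> {0..1}" "z \<in> {0..1}" "t \<in> {0..1}" for x y z t
  proof -
    have "h x y z t = x * y + x * z * t * (1 - y) + y * z * t * (1 - x)"
      by (simp add: h_def algebra_simps)
    also have "\<dots> \<ge> 0" using that by simp
    finally show ?thesis .
  qed
  have le: "(h x y y x)\<^sup>2 \<le> h x x y y * h y y x x" if "x \<in> {0..1}" "y \<in> {0..1}" for x y
  proof -
    have "h x x y y * h y y x x - (h x y y x)\<^sup>2
        = (x - y)\<^sup>2 * (x * y) * (2 * (x * (1 - y)) + 2 * (y * (1 - x)) + x * y)"
      by (simp add: h_def power2_eq_square algebra_simps)
    also have "\<dots> \<ge> 0" using that by simp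
    finally show ?thesis by simp
  qed
  show ?thesis
    unfolding gh
    using a b by (intro prod_increment_AM_GM fin conjI nonneg le mult_nonneg_nonneg) force+
qed

section \<open>Independent blocks of a finite product measure\<close>

lemma prob_pair_pmf:
  "measure_pmf.prob (pair_pmf M N) S
    = measure_pmf.expectation M (\<lambda>x. measure_pmf.prob N {y. (x, y) \<in> S})"
proof -
  have "emeasure (pair_pmf M N) S = (\<integral>\<^sup>+z. indicator S z \<partial>pair_pmf M N)"
    by simp
  also have "\<dots> = (\<integral>\<^sup>+x. \<integral>\<^sup>+y. indicator {y. (x, y) \<in> S} y \<partial>N \<partial>M)"
    by (simp add: nn_integral_pair_pmf' indicator_def)
  also have "\<dots> = (\<integral>\<^sup>+x. ennreal (measure_pmf.prob N {y. (x, y) \<in> S}) \<partial>M)"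
    by (simp add: measure_pmf.emeasure_eq_measure)
  finally show ?thesis
    by (simp add: measure_def integral_eq_nn_integral)
qed

lemma prob_pair_pmf_Times:
  "measure_pmf.prob (pair_pmf M N) (A \<times> B) = measure_pmf.prob M A * measure_pmf.prob N B"
proof -
  have "measure_pmf.prob N {y. (x, y) \<in> A \<times> B} = indicator A x * measure_pmf.prob N B" for x
    by (auto simp: indicator_def)
  then show ?thesis by (simp add: prob_pair_pmf)
qed

text \<open>Events that depend on pairwise disjoint blocks \<open>A i\<close> of coordinates are independent.\<close>

lemma prob_Pi_pmf_blocks:
  fixes A :: "'i \<Rightarrow> 'e set"
  assumes "finite I" and "\<And>i. i \<in> I \<Longrightarrow> finite (A i)" and "disjoint_family_on A I"
    and "\<And>i f g. i \<in> I \<Longrightarrow> (\<And>x. x \<in> A i \<Longrightarrow> f x = g x) \<Longrightarrow> Q i f \<Longrightarrow> Q i g"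
  shows "measure_pmf.prob (Pi_pmf (\<Union>i\<in>I. A i) dflt p) {f. \<forall>i\<in>I. Q i f}
    = (\<Prod>i\<in>I. measure_pmf.prob (Pi_pmf (A i) dflt p) {f. Q i f})"
  using assms
proof (induction I rule: finite_induct)
  case (insert j I)
  let ?U = "\<Union>i\<in>I. A i"
  have disj: "A j \<inter> ?U = {}" "disjoint_family_on A I"
    using insert.prems(2) insert.hyps(2) by (auto simp: disjoint_family_on_def)
  let ?glue = "\<lambda>(f, g) x. if x \<in> A j then f x else g x"
  have Qj: "Q j (\<lambda>x. if x \<in> A j then f x else g x) = Q j f" for f g
    using insert.prems(3)[of j f "\<lambda>x. if x \<in> A j then f x else g x"]
      insert.prems(3)[of j "\<lambda>x. if x \<in> A j then f x else g x" f] by auto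
  have Qi: "Q i (\<lambda>x. if x \<in> A j then f x else g x) = Q i g" if "i \<in> I" for i f g
  proof -
    have "x \<notin> A j" if "x \<in> A i" for x using disj that \<open>i \<in> I\<close> by auto
    then show ?thesis
      using insert.prems(3)[of i g "\<lambda>x. if x \<in> A j then f x else g x"]
        insert.prems(3)[of i "\<lambda>x. if x \<in> A j then f x else g x" g] \<open>i \<in> I\<close> by auto
  qed
  have eq: "?glue -` {f. \<forall>i\<in>insert j I. Q i f} = {f. Q j f} \<times> {f. \<forall>i\<in>I. Q i f}"
    by (auto simp: Qj Qi)
  have "measure_pmf.prob (Pi_pmf (\<Union>i\<in>insert j I. A i) dflt p) {f. \<forall>i\<in>insert j I. Q i f}
      = measure_pmf.prob (map_pmf ?glue (pair_pmf (Pi_pmf (A j) dflt p) (Pi_pmf ?U dflt p)))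
          {f. \<forall>i\<in>insert j I. Q i f}"
    using insert.prems(1) insert.hyps(1) disj(1) by (simp add: Pi_pmf_union)
  also have "\<dots> = measure_pmf.prob (Pi_pmf (A j) dflt p) {f. Q j f}
      * measure_pmf.prob (Pi_pmf ?U dflt p) {f. \<forall>i\<in>I. Q i f}"
    by (simp only: measure_map_pmf eq prob_pair_pmf_Times)
  also have "measure_pmf.prob (Pi_pmf ?U dflt p) {f. \<forall>i\<in>I. Q i f}
      = (\<Prod>i\<in>I. measure_pmf.prob (Pi_pmf (A i) dflt p) {f. Q i f})"
    using insert.prems disj(2) by (intro insert.IH) auto
  finally show ?case using insert.hyps by simp
qed simp

text \<open>
  \<open>Pi_pmf_bij_betw\<close> requires identically distributed coordinates; here the distribution of a coordinate only
  has to be invariant under \<open>h\<close>.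
\<close>

lemma Pi_pmf_involution:
  assumes fin: "finite A" and inv: "\<And>x. h (h x) = x" and img: "\<And>x. x \<in> A \<Longrightarrow> h x \<in> A"
    and p: "\<And>x. x \<in> A \<Longrightarrow> p (h x) = p x"
  shows "map_pmf (\<lambda>f. f \<circ> h) (Pi_pmf A dflt p) = Pi_pmf A dflt p"
proof (rule pmf_eqI)
  fix f
  have inj: "inj (\<lambda>f :: 'a \<Rightarrow> 'b. f \<circ> h)"
    by (rule injI) (metis comp_apply ext inv)
  have A: "h x \<in> A \<longleftrightarrow> x \<in> A" for x using img inv by metis
  have bij: "bij_betw h A A" by (rule bij_betwI[of _ _ _ h]) (auto simp: img inv)
  have "pmf (map_pmf (\<lambda>f. f \<circ> h) (Pi_pmf A dflt p)) f
      = pmf (map_pmf (\<lambda>f. f \<circ> h) (Pi_pmf A dflt p)) ((f \<circ> h) \<circ> h)"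
    by (simp add: comp_def inv)
  also have "\<dots> = pmf (Pi_pmf A dflt p) (f \<circ> h)"
    by (rule pmf_map_inj'[OF inj])
  also have "\<dots> = pmf (Pi_pmf A dflt p) f"
  proof -
    have "(\<Prod>x\<in>A. pmf (p x) (f (h x))) = (\<Prod>x\<in>A. pmf (p (h x)) (f (h x)))"
      by (simp add: p)
    also have "\<dots> = (\<Prod>x\<in>A. pmf (p x) (f x))"
      by (rule prod.reindex_bij_betw[OF bij])
    finally show ?thesis
      using A inv by (simp add: pmf_Pi[OF fin]) metis
  qed
  finally show "pmf (map_pmf (\<lambda>f. f \<circ> h) (Pi_pmf A dflt p)) f = pmf (Pi_pmf A dflt p) f" .
qed


section \<open>Reachability by open edges\<close>

text \<open>
  A graph is given by its set \<open>F\<close> of edges, and a configuration \<open>\<omega>\<close> says which edges are open.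
\<close>

definition adjacent :: "'b set set \<Rightarrow> ('b set \<Rightarrow> bool) \<Rightarrow> 'b \<Rightarrow> 'b \<Rightarrow> bool" where
  "adjacent F \<omega> x y \<longleftrightarrow> {x, y} \<in> F \<and> \<omega> {x, y}"

definition reachable :: "'b set set \<Rightarrow> ('b set \<Rightarrow> bool) \<Rightarrow> 'b \<Rightarrow> 'b \<Rightarrow> bool" where
  "reachable F \<omega> = (adjacent F \<omega>)\<^sup>*\<^sup>*"

text \<open>The open clusters of the subgraph induced on the vertex set \<open>R\<close>.\<close>

definition clusters :: "'b set set \<Rightarrow> 'b set \<Rightarrow> ('b set \<Rightarrow> bool) \<Rightarrow> 'b set set" where
  "clusters F R \<omega> = (\<lambda>z. {z'. reachable {e \<in> F. e \<subseteq> R} \<omega> z z'}) ` R"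

text \<open>An open edge joins \<open>y\<close> to a vertex of \<open>C\<close>.\<close>

definition touches :: "'b set set \<Rightarrow> ('b set \<Rightarrow> bool) \<Rightarrow> 'b \<Rightarrow> 'b set \<Rightarrow> bool" where
  "touches F \<omega> y C \<longleftrightarrow> (\<exists>z\<in>C. adjacent F \<omega> y z)"

text \<open>The edges between a terminal in \<open>T\<close> and a vertex of \<open>C\<close>.\<close>

definition star :: "'b set set \<Rightarrow> 'b set \<Rightarrow> 'b set \<Rightarrow> 'b set set" where
  "star F T C = {{y, z} | y z. y \<in> T \<and> z \<in> C \<and> {y, z} \<in> F}"

lemma adjacent_sym: "adjacent F \<omega> x y \<Longrightarrow> adjacent F \<omega> y x"
  by (simp add: adjacent_def insert_commute)

lemma reachable_refl: "reachable F \<omega> x x"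
  by (simp add: reachable_def)

lemma reachable_trans: "reachable F \<omega> x y \<Longrightarrow> reachable F \<omega> y z \<Longrightarrow> reachable F \<omega> x z"
  by (simp add: reachable_def)

lemma reachable_sym: "reachable F \<omega> x y \<Longrightarrow> reachable F \<omega> y x"
  unfolding reachable_def
  by (metis adjacent_sym sympD sympI symp_rtranclp)

lemma reachable_commute: "reachable F \<omega> x y \<longleftrightarrow> reachable F \<omega> y x"
  by (blast intro: reachable_sym)

lemma adjacent_imp_reachable: "adjacent F \<omega> x y \<Longrightarrow> reachable F \<omega> x y"
  by (simp add: reachable_def)

lemma reachable_mono: "F \<subseteq> F' \<Longrightarrow> reachable F \<omega> x y \<Longrightarrow> reachable F' \<omega> x y"
  unfolding reachable_def by (erule rtranclp_mono[THEN predicate2D, rotated]) (auto simp: adjacent_def)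

lemma cluster_subset: "C \<in> clusters F R \<omega> \<Longrightarrow> C \<subseteq> R"
proof
  fix z' assume "C \<in> clusters F R \<omega>" "z' \<in> C"
  then obtain z where "z \<in> R" "reachable {e \<in> F. e \<subseteq> R} \<omega> z z'" by (auto simp: clusters_def)
  from this(2,1) show "z' \<in> R"
    unfolding reachable_def by (induction rule: rtranclp_induct) (auto simp: adjacent_def)
qed

lemma cluster_exists: "z \<in> R \<Longrightarrow> \<exists>C\<in>clusters F R \<omega>. z \<in> C"
  by (auto simp: clusters_def intro: reachable_refl)

lemma cluster_reachable:
  assumes "C \<in> clusters F R \<omega>" "z \<in> C" "z' \<in> C"
  shows "reachable F \<omega> z z'"
proof -
  have "reachable {e \<in> F. e \<subseteq> R} \<omega> z z'"
    using assms by (auto simp: clusters_def intro: reachable_trans reachable_sym)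
  then show ?thesis by (rule reachable_mono[rotated]) auto
qed

lemma cluster_closed:
  assumes "C \<in> clusters F R \<omega>" "z \<in> C" "adjacent F \<omega> z z'" "z' \<in> R"
  shows "z' \<in> C"
proof -
  have "z \<in> R" using cluster_subset assms by blast
  with assms have "adjacent {e \<in> F. e \<subseteq> R} \<omega> z z'" by (simp add: adjacent_def)
  then show ?thesis
    using assms(1,2) by (auto simp: clusters_def intro: reachable_trans adjacent_imp_reachable)
qed

lemma clusters_disjoint:
  assumes "C \<in> clusters F R \<omega>" "C' \<in> clusters F R \<omega>" "z \<in> C" "z \<in> C'"
  shows "C = C'"
proof -
  let ?r = "reachable {e \<in> F. e \<subseteq> R} \<omega>"
  obtain c c' where c: "C = {z. ?r c z}" "C' = {z. ?r c' z}"
    using assms(1,2) by (auto simp: clusters_def)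
  then have "?r c z" "?r c' z" using assms(3,4) by auto
  then have "?r c c'" "?r c' c" by (blast intro: reachable_trans reachable_sym)+
  then show ?thesis unfolding c by (blast intro: reachable_trans)
qed

lemma clusters_cong:
  assumes "\<And>e. e \<in> F \<Longrightarrow> e \<subseteq> R \<Longrightarrow> \<omega> e = \<omega>' e"
  shows "clusters F R \<omega> = clusters F R \<omega>'"
proof -
  have "adjacent {e \<in> F. e \<subseteq> R} \<omega> = adjacent {e \<in> F. e \<subseteq> R} \<omega>'"
    using assms by (auto simp: fun_eq_iff adjacent_def)
  then show ?thesis by (simp add: clusters_def reachable_def)
qed

lemma touches_imp_reachable:
  assumes "C \<in> clusters F R \<omega>" "touches F \<omega> x C" "touches F \<omega> y C"
  shows "reachable F \<omega> x y"
  using assms unfolding touches_def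
  by (meson adjacent_imp_reachable adjacent_sym cluster_reachable reachable_trans)

text \<open>
  A set \<open>S\<close> of terminals is disconnected from the other terminals if no open edge and no cluster of
  non-terminals links the two sides.
\<close>

lemma not_reachable_if_separated:
  assumes F: "F \<subseteq> Pow (R \<union> T)" and RT: "R \<inter> T = {}" and "S \<subseteq> T"
    and noT: "\<And>x y. x \<in> S \<Longrightarrow> y \<in> T - S \<Longrightarrow> \<not> adjacent F \<omega> x y"
    and sep: "\<And>C x y. C \<in> clusters F R \<omega> \<Longrightarrow> x \<in> S \<Longrightarrow> y \<in> T - S
        \<Longrightarrow> touches F \<omega> x C \<Longrightarrow> touches F \<omega> y C \<Longrightarrow> False"
    and x: "x \<in> S" and y: "y \<in> T - S"
  shows "\<not> reachable F \<omega> x y"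
proof
  \<comment> \<open>The set \<open>S\<close> together with all clusters touched from \<open>S\<close> is closed under adjacency.\<close>
  let ?U = "S \<union> {z. \<exists>C\<in>clusters F R \<omega>. z \<in> C \<and> (\<exists>x\<in>S. touches F \<omega> x C)}"
  have closed: "z' \<in> ?U" if z: "z \<in> ?U" and adj: "adjacent F \<omega> z z'" for z z'
  proof -
    have "z' \<in> R \<union> T" using adj F by (auto simp: adjacent_def)
    then consider "z' \<in> S" | "z' \<in> T - S" | "z' \<in> R" by blast
    then show ?thesis
    proof cases
      case 2
      have "z \<notin> S" using noT 2 adj by blast
      then obtain C x where "C \<in> clusters F R \<omega>" "z \<in> C" "x \<in> S" "touches F \<omega> x C"
        using z by blast
      moreover have "touches F \<omega> z' C"
        using adjacent_sym[OF adj] \<open>z \<in> C\<close> by (auto simp: touches_def)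
      ultimately have False using sep 2 by blast
      then show ?thesis ..
    next
      case 3
      show ?thesis
      proof (cases "z \<in> S")
        case True
        obtain C where "C \<in> clusters F R \<omega>" "z' \<in> C" using cluster_exists 3 by metis
        then show ?thesis using True adj by (auto simp: touches_def)
      next
        case False
        then obtain C x where "C \<in> clusters F R \<omega>" "z \<in> C" "x \<in> S" "touches F \<omega> x C"
          using z by blast
        moreover have "z' \<in> C" by (rule cluster_closed) fact+
        ultimately show ?thesis by blast
      qed
    qed simp
  qed
  assume "reachable F \<omega> x y"
  then have "y \<in> ?U"
    unfolding reachable_def by (induction rule: rtranclp_induct) (use x closed in auto)
  then show False using y RT cluster_subset by blast
qed

text \<open>
  The terminals in \<open>T\<close> that are connected to \<open>x\<close> are exactly \<open>x\<close> and \<open>y\<close> (for \<open>x\<close> and \<open>y\<close> in \<open>T\<close>).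
\<close>

definition isolated_pair :: "'b set set \<Rightarrow> ('b set \<Rightarrow> bool) \<Rightarrow> 'b set \<Rightarrow> 'b \<Rightarrow> 'b \<Rightarrow> bool" where
  "isolated_pair F \<omega> T x y \<longleftrightarrow> reachable F \<omega> x y \<and> (\<forall>z\<in>T - {x, y}. \<not> reachable F \<omega> x z)"

lemma isolated_pair_iff:
  assumes F: "F \<subseteq> Pow (R \<union> T)" and RT: "R \<inter> T = {}"
    and T: "T = {y1, y2, y3, y4}" and dist: "distinct [y1, y2, y3, y4]"
    and noT: "\<And>x y. x \<in> T \<Longrightarrow> y \<in> T \<Longrightarrow> x \<noteq> y \<Longrightarrow> \<not> adjacent F \<omega> x y"
  shows "isolated_pair F \<omega> T y1 y2 \<longleftrightarrow>
    (\<forall>C\<in>clusters F R \<omega>. \<not> ((touches F \<omega> y1 C \<or> touches F \<omega> y2 C) \<and> (touches F \<omega> y3 C \<or> touches F \<omega> y4 C)))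
    \<and> (\<exists>C\<in>clusters F R \<omega>. touches F \<omega> y1 C \<and> touches F \<omega> y2 C)"
    (is "?L \<longleftrightarrow> ?N \<and> ?M")
proof
  assume L: ?L
  then have r: "reachable F \<omega> y1 y2" "\<not> reachable F \<omega> y1 y3" "\<not> reachable F \<omega> y1 y4"
    using T dist by (auto simp: isolated_pair_def)
  then have "\<not> reachable F \<omega> y2 y3" "\<not> reachable F \<omega> y2 y4"
    using reachable_trans[OF r(1)] by blast+
  with r have N: ?N using touches_imp_reachable[of _ F R \<omega>] by blast
  have ?M
  proof (rule ccontr)
    assume "\<not> ?M"
    then have "\<not> reachable F \<omega> y1 y2"
      using N T dist noT by (intro not_reachable_if_separated[OF F RT, of "{y1}"]) auto
    then show False using r by simp
  qed
  with N show "?N \<and> ?M" by simp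
next
  assume NM: "?N \<and> ?M"
  have "\<not> reachable F \<omega> y1 z" if "z \<in> T - {y1, y2}" for z
    using that NM T dist noT by (intro not_reachable_if_separated[OF F RT, of "{y1, y2}"]) auto
  then show ?L using NM touches_imp_reachable by (auto simp: isolated_pair_def)
qed


section \<open>Connection probabilities between four terminals\<close>

text \<open>
  The probability that no open edge joins the terminal \<open>y\<close> to \<open>C\<close>, when the edge \<open>e\<close> is open with
  probability \<open>p e\<close>.
\<close>

definition miss :: "'b set set \<Rightarrow> ('b set \<Rightarrow> real) \<Rightarrow> 'b \<Rightarrow> 'b set \<Rightarrow> real" where
  "miss F p y C = (\<Prod>z\<in>{z \<in> C. {y, z} \<in> F}. 1 - p {y, z})"

lemma miss_bounds:
  assumes "\<And>e. e \<in> F \<Longrightarrow> p e \<in> {0..1}"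
  shows "miss F p y C \<in> {0..1}"
  using assms unfolding miss_def by (auto intro!: prod_nonneg prod_le_1)

lemma finite_star: "finite F \<Longrightarrow> finite (star F T C)"
  by (rule finite_subset[of _ F]) (auto simp: star_def)

lemma prob_no_touch:
  assumes finF: "finite F" and "K \<subseteq> T" "finite T" "finite C" and TC: "T \<inter> C = {}"
    and p: "\<And>e. e \<in> F \<Longrightarrow> p e \<in> {0..1}"
  shows "measure_pmf.prob (Pi_pmf (star F T C) False (\<lambda>e. bernoulli_pmf (p e)))
      {b. \<forall>y\<in>K. \<not> touches F b y C} = (\<Prod>y\<in>K. miss F p y C)"
proof -
  let ?B = "\<lambda>e. if e \<in> star F K C then {False} else UNIV"
  have sub: "star F K C \<subseteq> star F T C" using \<open>K \<subseteq> T\<close> by (auto simp: star_def)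
  have "finite K" using assms finite_subset by blast
  have eq: "{b. \<forall>y\<in>K. \<not> touches F b y C} = Pi (star F T C) ?B"
  proof (intro set_eqI iffI)
    fix b assume "b \<in> {b. \<forall>y\<in>K. \<not> touches F b y C}"
    then show "b \<in> Pi (star F T C) ?B"
      by (fastforce simp: Pi_def touches_def adjacent_def star_def)
  next
    fix b assume b: "b \<in> Pi (star F T C) ?B"
    have "\<not> b e" if "e \<in> star F K C" for e
      using b that sub by (auto simp: Pi_def)
    then show "b \<in> {b. \<forall>y\<in>K. \<not> touches F b y C}"
      by (auto simp: touches_def adjacent_def star_def)
  qed
  have closed: "measure_pmf.prob (bernoulli_pmf (p e)) {False} = 1 - p e" if "e \<in> star F K C" for e
    using p[of e] that by (auto simp: measure_pmf_single star_def)
  have "measure_pmf.prob (Pi_pmf (star F T C) False (\<lambda>e. bernoulli_pmf (p e))) (Pi (star F T C) ?B)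
      = (\<Prod>e\<in>star F T C. measure_pmf.prob (bernoulli_pmf (p e)) (?B e))"
    by (rule measure_Pi_pmf_Pi[OF finite_star[OF finF]])
  also have "\<dots> = (\<Prod>e\<in>star F K C. 1 - p e)"
    using sub closed by (intro prod.mono_neutral_cong_right finite_star finF) auto
  also have "\<dots> = (\<Prod>e\<in>(\<lambda>(y, z). {y, z}) ` (SIGMA y:K. {z \<in> C. {y, z} \<in> F}). 1 - p e)"
    by (rule prod.cong) (auto simp: star_def)
  also have "\<dots> = (\<Prod>(y, z)\<in>(SIGMA y:K. {z \<in> C. {y, z} \<in> F}). 1 - p {y, z})"
    using TC \<open>K \<subseteq> T\<close> by (subst prod.reindex) (auto simp: inj_on_def doubleton_eq_iff case_prod_unfold)
  also have "\<dots> = (\<Prod>y\<in>K. miss F p y C)"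
    using \<open>finite K\<close> \<open>finite C\<close> by (subst prod.Sigma[symmetric]) (auto simp: miss_def)
  finally show ?thesis unfolding eq .
qed

lemma prob_pmf_Un:
  "measure_pmf.prob M (A \<union> B)
    = measure_pmf.prob M A + measure_pmf.prob M B - measure_pmf.prob M (A \<inter> B)"
  by (simp add: measure_pmf.finite_measure_Union' measure_pmf.finite_measure_Diff' Int_commute)

text \<open>
  Both events below are unions of events "no terminal in \<open>K\<close> touches \<open>C\<close>", whose intersections are again of
  this form; inclusion-exclusion then gives their probabilities.
\<close>

lemma prob_pairs_separated:
  assumes "finite F" "finite C" "T = {y1, y2, y3, y4}" "T \<inter> C = {}" "distinct [y1, y2, y3, y4]"
    and "\<And>e. e \<in> F \<Longrightarrow> p e \<in> {0..1}"
  defines "P \<equiv> \<lambda>\<phi>. measure_pmf.prob (Pi_pmf (star F T C) False (\<lambda>e. bernoulli_pmf (p e))) {b. \<phi> (\<lambda>y. touches F b y C)}"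
    and "k1 \<equiv> miss F p y1 C" and "k2 \<equiv> miss F p y2 C" and "k3 \<equiv> miss F p y3 C" and "k4 \<equiv> miss F p y4 C"
  shows "P (\<lambda>t. \<not> ((t y1 \<or> t y2) \<and> (t y3 \<or> t y4))) = k1 * k2 + k3 * k4 - k1 * k2 * k3 * k4" (is ?g)
    and "P (\<lambda>t. \<not> ((t y1 \<or> t y2) \<and> (t y3 \<or> t y4)) \<and> \<not> (t y1 \<and> t y2))
      = k1 * k2 + k1 * k3 * k4 + k2 * k3 * k4 - 2 * (k1 * k2 * k3 * k4)" (is ?h)
proof -
  let ?N = "\<lambda>K. {b. \<forall>y\<in>K. \<not> touches F b y C}"
  let ?pr = "\<lambda>K. measure_pmf.prob (Pi_pmf (star F T C) False (\<lambda>e. bernoulli_pmf (p e))) (?N K)"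
  have prob: "?pr K = (\<Prod>y\<in>K. miss F p y C)" if "K \<subseteq> T" for K
    using assms that by (intro prob_no_touch) auto
  have g: "{b. \<not> ((touches F b y1 C \<or> touches F b y2 C) \<and> (touches F b y3 C \<or> touches F b y4 C))}
      = ?N {y1, y2} \<union> ?N {y3, y4}" by auto
  have h: "{b. \<not> ((touches F b y1 C \<or> touches F b y2 C) \<and> (touches F b y3 C \<or> touches F b y4 C))
        \<and> \<not> (touches F b y1 C \<and> touches F b y2 C)}
      = ?N {y1, y2} \<union> (?N {y1, y3, y4} \<union> ?N {y2, y3, y4})" by auto
  have N: "?N K \<inter> ?N L = ?N (K \<union> L)" for K L by auto
  have unions: "{y1, y2} \<union> {y3, y4} = T" "{y1, y2} \<union> {y1, y3, y4} = T"
    "{y1, y2} \<union> {y2, y3, y4} = T" "{y1, y3, y4} \<union> {y2, y3, y4} = T"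
    using assms(3) by auto
  have probs: "?pr {y1, y2} = k1 * k2" "?pr {y3, y4} = k3 * k4" "?pr {y1, y3, y4} = k1 * k3 * k4"
    "?pr {y2, y3, y4} = k2 * k3 * k4" "?pr T = k1 * k2 * k3 * k4"
    using assms by (subst prob; auto)+
  show ?g
    unfolding P_def g prob_pmf_Un N unions probs ..
  show ?h
    unfolding P_def h prob_pmf_Un Int_Un_distrib N unions Un_absorb probs by simp
qed

text \<open>The configuration that agrees with \<open>d\<close> on \<open>D\<close> and with \<open>b\<close> elsewhere.\<close>

definition glue :: "'b set set \<Rightarrow> ('b set \<Rightarrow> bool) \<Rightarrow> ('b set \<Rightarrow> bool) \<Rightarrow> 'b set \<Rightarrow> bool" where
  "glue D d b e = (if e \<in> D then d e else b e)"

text \<open>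
  The probability that \<open>y1, y2\<close> is an isolated pair, given the state \<open>d\<close> of the edges that do not join a
  terminal to a non-terminal, when no edge between different terminals is open in \<open>d\<close>. The first product
  is the probability that no cluster links \<open>y1, y2\<close> to \<open>y3, y4\<close>; subtracting the second one leaves the
  case that some cluster also links \<open>y1\<close> to \<open>y2\<close>.
\<close>

lemma prob_isolated_pair:
  fixes F :: "'b set set" and p :: "'b set \<Rightarrow> real"
  assumes finF: "finite F" and finR: "finite R" and F: "F \<subseteq> Pow (R \<union> T)" and RT: "R \<inter> T = {}"
    and T: "T = {y1, y2, y3, y4}" and dist: "distinct [y1, y2, y3, y4]"
    and p: "\<And>e. e \<in> F \<Longrightarrow> p e \<in> {0..1}"
    and noT: "\<And>x y. x \<in> T \<Longrightarrow> y \<in> T \<Longrightarrow> x \<noteq> y \<Longrightarrow> \<not> adjacent F d x y"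
  defines "\<kappa> \<equiv> miss F p" and "S \<equiv> star F T R"
  shows "measure_pmf.prob (Pi_pmf S False (\<lambda>e. bernoulli_pmf (p e)))
      {b. isolated_pair F (glue (F - S) d b) T y1 y2}
    = (\<Prod>C\<in>clusters F R d. \<kappa> y1 C * \<kappa> y2 C + \<kappa> y3 C * \<kappa> y4 C - \<kappa> y1 C * \<kappa> y2 C * \<kappa> y3 C * \<kappa> y4 C)
    - (\<Prod>C\<in>clusters F R d. \<kappa> y1 C * \<kappa> y2 C + \<kappa> y1 C * \<kappa> y3 C * \<kappa> y4 C + \<kappa> y2 C * \<kappa> y3 C * \<kappa> y4 C
        - 2 * (\<kappa> y1 C * \<kappa> y2 C * \<kappa> y3 C * \<kappa> y4 C))"
proof -
  let ?\<omega> = "glue (F - S) d"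
  let ?\<C> = "clusters F R d"
  let ?P = "Pi_pmf S False (\<lambda>e. bernoulli_pmf (p e))"
  define g where "g = (\<lambda>t. \<not> ((t y1 \<or> t y2) \<and> (t y3 \<or> t y4)))"
  define h where "h = (\<lambda>t. \<not> ((t y1 \<or> t y2) \<and> (t y3 \<or> t y4)) \<and> \<not> (t y1 \<and> t y2))"
  have fin\<C>: "finite ?\<C>" using finR by (simp add: clusters_def)
  have sub: "C \<subseteq> R" "finite C" "T \<inter> C = {}" if "C \<in> ?\<C>" for C
    using cluster_subset[OF that] finR RT by (auto intro: finite_subset)
  have cl: "clusters F R (?\<omega> b) = ?\<C>" for b
    using RT by (intro clusters_cong) (auto simp: glue_def S_def star_def)
  have touch: "touches F (?\<omega> b) y C \<longleftrightarrow> touches F b y C" if "y \<in> T" "C \<in> ?\<C>" for b y C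
  proof -
    have "adjacent F (?\<omega> b) y z \<longleftrightarrow> adjacent F b y z" if "z \<in> C" for z
      using that \<open>y \<in> T\<close> sub(1)[OF \<open>C \<in> ?\<C>\<close>] by (auto simp: adjacent_def glue_def S_def star_def)
    then show ?thesis by (simp add: touches_def)
  qed
  have noT': "\<not> adjacent F (?\<omega> b) x y" if "x \<in> T" "y \<in> T" "x \<noteq> y" for b x y
  proof -
    have "{x, y} \<notin> S" using that RT by (auto simp: S_def star_def doubleton_eq_iff)
    then show ?thesis using noT[OF that] by (auto simp: adjacent_def glue_def)
  qed
  have iff: "isolated_pair F (?\<omega> b) T y1 y2 \<longleftrightarrow>
      (\<forall>C\<in>?\<C>. g (\<lambda>y. touches F b y C)) \<and> \<not> (\<forall>C\<in>?\<C>. h (\<lambda>y. touches F b y C))" for b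
  proof -
    have "isolated_pair F (?\<omega> b) T y1 y2 \<longleftrightarrow>
      (\<forall>C\<in>?\<C>. g (\<lambda>y. touches F (?\<omega> b) y C))
      \<and> (\<exists>C\<in>?\<C>. touches F (?\<omega> b) y1 C \<and> touches F (?\<omega> b) y2 C)"
      using isolated_pair_iff[OF F RT T dist noT'] by (simp add: cl g_def)
    also have "\<dots> \<longleftrightarrow> (\<forall>C\<in>?\<C>. g (\<lambda>y. touches F b y C)) \<and> (\<exists>C\<in>?\<C>. touches F b y1 C \<and> touches F b y2 C)"
      using T touch by (auto simp: g_def)
    finally show ?thesis by (auto simp: g_def h_def)
  qed
  \<comment> \<open>The edges between terminals and non-terminals split into one block for each cluster.\<close>
  have S: "S = (\<Union>C\<in>?\<C>. star F T C)"
  proof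
    show "S \<subseteq> (\<Union>C\<in>?\<C>. star F T C)"
    proof
      fix e assume "e \<in> S"
      then obtain y z where e: "e = {y, z}" "y \<in> T" "z \<in> R" "{y, z} \<in> F"
        by (auto simp: S_def star_def)
      then obtain C where "C \<in> ?\<C>" "z \<in> C" using cluster_exists by metis
      with e show "e \<in> (\<Union>C\<in>?\<C>. star F T C)" by (auto simp: star_def)
    qed
    show "(\<Union>C\<in>?\<C>. star F T C) \<subseteq> S" using sub(1) by (fastforce simp: S_def star_def)
  qed
  have disj: "disjoint_family_on (star F T) ?\<C>"
    unfolding disjoint_family_on_def
  proof (intro ballI impI equals0I)
    fix C C' e assume C: "C \<in> ?\<C>" "C' \<in> ?\<C>" "C \<noteq> C'" "e \<in> star F T C \<inter> star F T C'"
    then obtain y z y' z' where "{y, z} = {y', z'}" "y \<in> T" "y' \<in> T" "z \<in> C" "z' \<in> C'"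
      by (auto simp: star_def)
    then have "z = z'" using sub(3)[OF C(1)] sub(3)[OF C(2)] by (auto simp: doubleton_eq_iff)
    then show False
      using clusters_disjoint[OF C(1,2), of z] C(3) \<open>z \<in> C\<close> \<open>z' \<in> C'\<close> by simp
  qed
  have touch_cong: "touches F b y C = touches F b' y C"
    if "\<And>e. e \<in> star F T C \<Longrightarrow> b e = b' e" "y \<in> T" for b b' y C
  proof -
    have "adjacent F b y z \<longleftrightarrow> adjacent F b' y z" if "z \<in> C" for z
      using that \<open>y \<in> T\<close> \<open>\<And>e. e \<in> star F T C \<Longrightarrow> b e = b' e\<close>[of "{y, z}"]
      by (auto simp: adjacent_def star_def)
    then show ?thesis by (simp add: touches_def)
  qed
  have blocks: "measure_pmf.prob ?P {b. \<forall>C\<in>?\<C>. \<phi> (\<lambda>y. touches F b y C)}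
      = (\<Prod>C\<in>?\<C>. measure_pmf.prob (Pi_pmf (star F T C) False (\<lambda>e. bernoulli_pmf (p e)))
          {b. \<phi> (\<lambda>y. touches F b y C)})"
    if \<phi>: "\<And>t t'. (\<And>y. y \<in> T \<Longrightarrow> t y = t' y) \<Longrightarrow> \<phi> t \<Longrightarrow> \<phi> t'" for \<phi>
    unfolding S
  proof (rule prob_Pi_pmf_blocks[OF fin\<C> finite_star[OF finF] disj])
    fix C b b' assume eq: "\<And>e. e \<in> star F T C \<Longrightarrow> b e = b' e" and "\<phi> (\<lambda>y. touches F b y C)"
    show "\<phi> (\<lambda>y. touches F b' y C)"
      by (rule \<phi>[OF touch_cong[OF eq]]) (assumption | fact)+
  qed
  have "{b. isolated_pair F (?\<omega> b) T y1 y2}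
      = {b. \<forall>C\<in>?\<C>. g (\<lambda>y. touches F b y C)} - {b. \<forall>C\<in>?\<C>. h (\<lambda>y. touches F b y C)}"
    by (auto simp: iff)
  then have "measure_pmf.prob ?P {b. isolated_pair F (?\<omega> b) T y1 y2} = measure_pmf.prob ?P
      ({b. \<forall>C\<in>?\<C>. g (\<lambda>y. touches F b y C)} - {b. \<forall>C\<in>?\<C>. h (\<lambda>y. touches F b y C)})"
    by (rule arg_cong)
  also have "\<dots> = measure_pmf.prob ?P {b. \<forall>C\<in>?\<C>. g (\<lambda>y. touches F b y C)}
      - measure_pmf.prob ?P {b. \<forall>C\<in>?\<C>. h (\<lambda>y. touches F b y C)}"
    by (rule measure_pmf.finite_measure_Diff) (auto simp: g_def h_def)
  also have "measure_pmf.prob ?P {b. \<forall>C\<in>?\<C>. g (\<lambda>y. touches F b y C)}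
      = (\<Prod>C\<in>?\<C>. \<kappa> y1 C * \<kappa> y2 C + \<kappa> y3 C * \<kappa> y4 C - \<kappa> y1 C * \<kappa> y2 C * \<kappa> y3 C * \<kappa> y4 C)"
    using T prob_pairs_separated(1)[OF finF sub(2) T sub(3) dist p]
    by (subst blocks) (auto simp: g_def \<kappa>_def intro!: prod.cong)
  also have "measure_pmf.prob ?P {b. \<forall>C\<in>?\<C>. h (\<lambda>y. touches F b y C)}
      = (\<Prod>C\<in>?\<C>. \<kappa> y1 C * \<kappa> y2 C + \<kappa> y1 C * \<kappa> y3 C * \<kappa> y4 C + \<kappa> y2 C * \<kappa> y3 C * \<kappa> y4 C
        - 2 * (\<kappa> y1 C * \<kappa> y2 C * \<kappa> y3 C * \<kappa> y4 C))"
    using T prob_pairs_separated(2)[OF finF sub(2) T sub(3) dist p]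
    by (subst blocks) (auto simp: h_def \<kappa>_def intro!: prod.cong)
  finally show ?thesis .
qed


text \<open>
  Conditionally on \<open>d\<close>, the two mixed pairs \<open>y1, y4\<close> and \<open>y2, y3\<close> have the same probability of being isolated,
  because \<open>y1\<close> and \<open>y2\<close> miss a cluster with equal probability, as do \<open>y3\<close> and \<open>y4\<close>.
\<close>

lemma twin_pairs_given_rest:
  fixes F :: "'b set set" and p :: "'b set \<Rightarrow> real"
  assumes finF: "finite F" and finR: "finite R" and F: "F \<subseteq> Pow (R \<union> T)" and RT: "R \<inter> T = {}"
    and T: "T = {y1, y2, y3, y4}" and dist: "distinct [y1, y2, y3, y4]"
    and p: "\<And>e. e \<in> F \<Longrightarrow> p e \<in> {0..1}"
    and twin12: "\<And>z. z \<in> R \<Longrightarrow> ({y1, z} \<in> F \<longleftrightarrow> {y2, z} \<in> F) \<and> p {y1, z} = p {y2, z}"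
    and twin34: "\<And>z. z \<in> R \<Longrightarrow> ({y3, z} \<in> F \<longleftrightarrow> {y4, z} \<in> F) \<and> p {y3, z} = p {y4, z}"
    and noT: "\<And>x y. x \<in> T \<Longrightarrow> y \<in> T \<Longrightarrow> x \<noteq> y \<Longrightarrow> \<not> adjacent F d x y"
  defines "P \<equiv> \<lambda>x y. measure_pmf.prob (Pi_pmf (star F T R) False (\<lambda>e. bernoulli_pmf (p e)))
      {b. isolated_pair F (glue (F - star F T R) d b) T x y}"
  shows "P y1 y4 + P y2 y3 \<le> P y1 y2 + P y3 y4"
proof -
  have fin: "finite (clusters F R d)" using finR by (simp add: clusters_def)
  have bounds: "miss F p y C \<in> {0..1}" for y C using p by (rule miss_bounds)
  have eq12: "miss F p y2 C = miss F p y1 C" and eq34: "miss F p y4 C = miss F p y3 C"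
    if "C \<in> clusters F R d" for C
    using twin12 twin34 cluster_subset[OF that] unfolding miss_def by (auto intro!: prod.cong)
  have dists: "distinct [y1, y4, y3, y2]" "distinct [y2, y3, y4, y1]" "distinct [y3, y4, y1, y2]"
    and Ts: "T = {y1, y4, y3, y2}" "T = {y2, y3, y4, y1}" "T = {y3, y4, y1, y2}"
    using dist T by auto
  have prob: "P x1 x2 = (\<Prod>C\<in>clusters F R d. miss F p x1 C * miss F p x2 C + miss F p x3 C * miss F p x4 C
        - miss F p x1 C * miss F p x2 C * miss F p x3 C * miss F p x4 C)
    - (\<Prod>C\<in>clusters F R d. miss F p x1 C * miss F p x2 C + miss F p x1 C * miss F p x3 C * miss F p x4 C
        + miss F p x2 C * miss F p x3 C * miss F p x4 C
        - 2 * (miss F p x1 C * miss F p x2 C * miss F p x3 C * miss F p x4 C))"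
    if "T = {x1, x2, x3, x4}" "distinct [x1, x2, x3, x4]" for x1 x2 x3 x4
    unfolding P_def by (rule prob_isolated_pair[OF finF finR F RT that p noT])
  let ?a = "miss F p y1" and ?b = "miss F p y3"
  have P12: "P y1 y2 = (\<Prod>C\<in>clusters F R d. ?a C * ?a C + ?b C * ?b C - ?a C * ?a C * ?b C * ?b C)
    - (\<Prod>C\<in>clusters F R d. ?a C * ?a C + ?a C * ?b C * ?b C + ?a C * ?b C * ?b C - 2 * (?a C * ?a C * ?b C * ?b C))"
    by (simp only: prob[OF T dist] eq12 eq34 cong: prod.cong)
  have P14: "P y1 y4 = (\<Prod>C\<in>clusters F R d. ?a C * ?b C + ?b C * ?a C - ?a C * ?b C * ?b C * ?a C)
    - (\<Prod>C\<in>clusters F R d. ?a C * ?b C + ?a C * ?b C * ?a C + ?b C * ?b C * ?a C - 2 * (?a C * ?b C * ?b C * ?a C))"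
    by (simp only: prob[OF Ts(1) dists(1)] eq12 eq34 cong: prod.cong)
  have P23: "P y2 y3 = (\<Prod>C\<in>clusters F R d. ?a C * ?b C + ?b C * ?a C - ?a C * ?b C * ?b C * ?a C)
    - (\<Prod>C\<in>clusters F R d. ?a C * ?b C + ?a C * ?b C * ?a C + ?b C * ?b C * ?a C - 2 * (?a C * ?b C * ?b C * ?a C))"
    by (simp only: prob[OF Ts(2) dists(2)] eq12 eq34 cong: prod.cong)
  have P34: "P y3 y4 = (\<Prod>C\<in>clusters F R d. ?b C * ?b C + ?a C * ?a C - ?b C * ?b C * ?a C * ?a C)
    - (\<Prod>C\<in>clusters F R d. ?b C * ?b C + ?b C * ?a C * ?a C + ?b C * ?a C * ?a C - 2 * (?b C * ?b C * ?a C * ?a C))"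
    by (simp only: prob[OF Ts(3) dists(3)] eq12 eq34 cong: prod.cong)
  have "2 * P y1 y4 \<le> P y1 y2 + P y3 y4"
    unfolding P12 P14 P34 by (rule twin_product_inequality[OF fin bounds bounds])
  moreover have "P y2 y3 = P y1 y4"
    unfolding P14 P23 ..
  ultimately show ?thesis by simp
qed

text \<open>
  Here \<open>rij\<close> says that the terminals \<open>i\<close> and \<open>j\<close> are connected, and the hypothesis is transitivity.
\<close>

lemma isolated_pairs_count:
  "(r12 \<longrightarrow> r13 = r23) \<and> (r13 \<longrightarrow> r12 = r23) \<and> (r12 \<longrightarrow> r14 = r24) \<and> (r14 \<longrightarrow> r12 = r24)
    \<and> (r13 \<longrightarrow> r14 = r34) \<and> (r14 \<longrightarrow> r13 = r34) \<and> (r23 \<longrightarrow> r24 = r34) \<and> (r24 \<longrightarrow> r23 = r34)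
  \<Longrightarrow> of_bool r12 + of_bool r34 - of_bool r14 - of_bool r23
    = (of_bool (r12 \<and> \<not> r13 \<and> \<not> r14) + of_bool (r34 \<and> \<not> r13 \<and> \<not> r23)
      - of_bool (r14 \<and> \<not> r12 \<and> \<not> r13) - of_bool (r23 \<and> \<not> r12 \<and> \<not> r24) :: real)"
  by (induct r12; induct r13; induct r14; induct r23; simp)

text \<open>
  Both sides depend only on the partition of the terminals into clusters. They agree if all clusters have
  at most two terminals, since a connected pair is then isolated. If some cluster has at least three terminals,
  no pair is isolated, and the connected pairs on the left cancel.
\<close>

lemma isolated_pairs_decomposition:
  assumes T: "T = {y1, y2, y3, y4}" and dist: "distinct [y1, y2, y3, y4]"
  shows "of_bool (reachable F \<omega> y1 y2) + of_bool (reachable F \<omega> y3 y4)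
      - of_bool (reachable F \<omega> y1 y4) - of_bool (reachable F \<omega> y2 y3)
    = (of_bool (isolated_pair F \<omega> T y1 y2) + of_bool (isolated_pair F \<omega> T y3 y4)
      - of_bool (isolated_pair F \<omega> T y1 y4) - of_bool (isolated_pair F \<omega> T y2 y3) :: real)"
proof -
  let ?r = "reachable F \<omega>"
  have iso: "isolated_pair F \<omega> T y1 y2 \<longleftrightarrow> ?r y1 y2 \<and> \<not> ?r y1 y3 \<and> \<not> ?r y1 y4"
    "isolated_pair F \<omega> T y3 y4 \<longleftrightarrow> ?r y3 y4 \<and> \<not> ?r y1 y3 \<and> \<not> ?r y2 y3"
    "isolated_pair F \<omega> T y1 y4 \<longleftrightarrow> ?r y1 y4 \<and> \<not> ?r y1 y2 \<and> \<not> ?r y1 y3"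
    "isolated_pair F \<omega> T y2 y3 \<longleftrightarrow> ?r y2 y3 \<and> \<not> ?r y1 y2 \<and> \<not> ?r y2 y4"
    using T dist by (auto simp: isolated_pair_def intro: reachable_sym)
  have trans: "(?r x y \<longrightarrow> ?r x z = ?r y z) \<and> (?r x z \<longrightarrow> ?r x y = ?r y z)" for x y z
    by (blast intro: reachable_trans reachable_sym)
  show ?thesis
    unfolding iso
    by (rule isolated_pairs_count) (intro conjI trans[THEN conjunct1] trans[THEN conjunct2])
qed

text \<open>
  In independent percolation on a finite graph with terminals \<open>y1, y2, y3, y4\<close>, where \<open>y1, y2\<close> and
  \<open>y3, y4\<close> are pairs of twins with respect to the set \<open>R\<close> of other vertices, connections within the pairs
  of twins are at least as likely in total as the connections \<open>y1 \<leftrightarrow> y4\<close> and \<open>y2 \<leftrightarrow> y3\<close>, provided that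
  neither \<open>y1 y4\<close> nor \<open>y2 y3\<close> is an edge.
\<close>

theorem twin_pairs_connection:
  fixes F :: "'b set set" and p :: "'b set \<Rightarrow> real"
  assumes finF: "finite F" and finR: "finite R" and F: "F \<subseteq> Pow (R \<union> T)" and RT: "R \<inter> T = {}"
    and T: "T = {y1, y2, y3, y4}" and dist: "distinct [y1, y2, y3, y4]"
    and p: "\<And>e. e \<in> F \<Longrightarrow> p e \<in> {0..1}"
    and twin12: "\<And>z. z \<in> R \<Longrightarrow> ({y1, z} \<in> F \<longleftrightarrow> {y2, z} \<in> F) \<and> p {y1, z} = p {y2, z}"
    and twin34: "\<And>z. z \<in> R \<Longrightarrow> ({y3, z} \<in> F \<longleftrightarrow> {y4, z} \<in> F) \<and> p {y3, z} = p {y4, z}"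
    and diagonal: "{y1, y4} \<notin> F" "{y2, y3} \<notin> F"
  defines "P \<equiv> \<lambda>x y. measure_pmf.prob (Pi_pmf F False (\<lambda>e. bernoulli_pmf (p e))) {\<omega>. reachable F \<omega> x y}"
  shows "P y1 y4 + P y2 y3 \<le> P y1 y2 + P y3 y4"
proof -
  let ?M = "\<lambda>A. Pi_pmf A False (\<lambda>e. bernoulli_pmf (p e))"
  define S where "S = star F T R"
  define Q where "Q x y = measure_pmf.prob (?M F) {\<omega>. isolated_pair F \<omega> T x y}" for x y
  define q where "q x y d = measure_pmf.prob (?M S) {b. isolated_pair F (glue (F - S) d b) T x y}" for x y d
  have "S \<subseteq> F" by (auto simp: S_def star_def)
  then have "?M F = ?M ((F - S) \<union> S)" by (simp add: Un_absorb2)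
  also have "\<dots> = map_pmf (\<lambda>(d, b). glue (F - S) d b) (pair_pmf (?M (F - S)) (?M S))"
    using finF \<open>S \<subseteq> F\<close> by (subst Pi_pmf_union) (auto simp: glue_def fun_eq_iff finite_subset intro!: map_pmf_cong)
  finally have Q: "Q x y = measure_pmf.expectation (?M (F - S)) (q x y)" for x y
    by (simp add: Q_def q_def[abs_def] prob_pair_pmf vimage_def case_prod_unfold)
  have integrable: "integrable (?M (F - S)) (q x y)" for x y
    by (rule measure_pmf.integrable_const_bound[where B = 1]) (auto simp: q_def)
  have "q y1 y4 d + q y2 y3 d \<le> q y1 y2 d + q y3 y4 d" for d
  proof (cases "\<exists>x\<in>T. \<exists>y\<in>T. x \<noteq> y \<and> adjacent F d x y")
    case True
    then obtain x y where xy: "x \<in> T" "y \<in> T" "x \<noteq> y" "adjacent F d x y" by blast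
    then have "{x, y} \<notin> S" using RT by (auto simp: S_def star_def doubleton_eq_iff)
    then have r: "reachable F (glue (F - S) d b) x y" "reachable F (glue (F - S) d b) y x" for b
      using xy by (auto simp: adjacent_def glue_def insert_commute intro!: adjacent_imp_reachable)
    \<comment> \<open>The open edge links \<open>{y1, y4}\<close> to \<open>{y2, y3}\<close>, so that neither is an isolated pair.\<close>
    have ends: "{x, y} \<noteq> {y1, y4}" "{x, y} \<noteq> {y2, y3}"
      using xy diagonal by (auto simp: adjacent_def)
    have none: "\<not> isolated_pair F (glue (F - S) d b) T y1 y4" "\<not> isolated_pair F (glue (F - S) d b) T y2 y3"
      for b
      using r[of b] ends xy T dist by (auto simp: isolated_pair_def insert_commute doubleton_eq_iff
          intro: reachable_trans reachable_sym)
    then show ?thesis by (simp add: q_def)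
  next
    case False
    then show ?thesis
      unfolding q_def S_def
      by (intro twin_pairs_given_rest[OF finF finR F RT T dist p twin12 twin34]) blast+
  qed
  then have Q_le: "Q y1 y4 + Q y2 y3 \<le> Q y1 y2 + Q y3 y4"
    unfolding Q
    by (simp add: Bochner_Integration.integral_add[symmetric] integrable integral_mono
        del: Bochner_Integration.integral_add)
  have prob: "measure_pmf.prob (?M F) {\<omega>. \<phi> \<omega>} = measure_pmf.expectation (?M F) (\<lambda>\<omega>. of_bool (\<phi> \<omega>))" for \<phi>
  proof -
    have "(\<lambda>\<omega>. of_bool (\<phi> \<omega>) :: real) = indicator {\<omega>. \<phi> \<omega>}" by (auto simp: fun_eq_iff)
    then show ?thesis by simp
  qed
  have int: "integrable (?M F) (\<lambda>\<omega>. of_bool (\<phi> \<omega>) :: real)" for \<phi>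
    by (rule measure_pmf.integrable_const_bound[where B = 1]) auto
  have "P y1 y2 + P y3 y4 - P y1 y4 - P y2 y3 = Q y1 y2 + Q y3 y4 - Q y1 y4 - Q y2 y3"
    unfolding P_def Q_def prob
    by (simp add: Bochner_Integration.integral_add[symmetric] Bochner_Integration.integral_diff[symmetric]
        int isolated_pairs_decomposition[OF T dist]
        del: Bochner_Integration.integral_add Bochner_Integration.integral_diff)
  then show ?thesis using Q_le by simp
qed

section \<open>The bunkbed graph\<close>

lemma joined_iff_reachable:
  assumes "simple_graph V E"
  shows "joined V E \<omega> x y \<longleftrightarrow> x \<in> bunkbed_verts V \<and> reachable (bunkbed_edges V E) \<omega> x y"
proof
  have path: "reachable (bunkbed_edges V E) \<omega> (hd xs) (last xs)"
    if "xs \<noteq> []" "successively (\<lambda>a b. {a, b} \<in> bunkbed_edges V E \<and> \<omega> {a, b}) xs" for xs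
    using that
  proof (induction xs)
    case (Cons a xs)
    show ?case
    proof (cases "xs = []")
      case False
      then have "adjacent (bunkbed_edges V E) \<omega> a (hd xs)" "reachable (bunkbed_edges V E) \<omega> (hd xs) (last xs)"
        using Cons by (auto simp: successively_Cons adjacent_def)
      then show ?thesis
        using False by (auto intro: reachable_trans adjacent_imp_reachable)
    qed (simp add: reachable_refl)
  qed simp
  assume "joined V E \<omega> x y"
  then obtain xs where xs: "open_path V E \<omega> xs" "hd xs = x" "last xs = y" by (auto simp: joined_def)
  then show "x \<in> bunkbed_verts V \<and> reachable (bunkbed_edges V E) \<omega> x y"
    using path[of xs] hd_in_set[of xs] by (auto simp: open_path_def)
next
  assume asm: "x \<in> bunkbed_verts V \<and> reachable (bunkbed_edges V E) \<omega> x y"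
  then have "(adjacent (bunkbed_edges V E) \<omega>)\<^sup>*\<^sup>* x y" by (simp add: reachable_def)
  then show "joined V E \<omega> x y"
  proof (induction rule: rtranclp_induct)
    case base
    have "open_path V E \<omega> [x]" using asm by (simp add: open_path_def)
    then show ?case unfolding joined_def by fastforce
  next
    case (step y z)
    then obtain xs where xs: "open_path V E \<omega> xs" "hd xs = x" "last xs = y" by (auto simp: joined_def)
    show ?case
    proof (cases "z \<in> set xs")
      \<comment> \<open>Vertices of an open path are distinct, so a walk that returns to \<open>z\<close> is cut at \<open>z\<close>.\<close>
      case True
      then obtain ys zs where "xs = (ys @ [z]) @ zs" by (auto dest: split_list)
      then have "open_path V E \<omega> (ys @ [z])" "hd (ys @ [z]) = x"
        using xs by (auto simp: open_path_def successively_append_iff hd_append)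
      then show ?thesis unfolding joined_def by (metis last_snoc)
    next
      case False
      have "{y, z} \<in> bunkbed_edges V E" "\<omega> {y, z}" using step by (auto simp: adjacent_def)
      moreover from this(1) have "z \<in> bunkbed_verts V"
        using assms by (fastforce simp: bunkbed_edges_def bunkbed_verts_def simple_graph_def doubleton_eq_iff)
      ultimately have "open_path V E \<omega> (xs @ [z])"
        using False xs by (auto simp: open_path_def successively_append_iff)
      moreover have "hd (xs @ [z]) = x" using xs by (auto simp: open_path_def hd_append)
      ultimately show ?thesis unfolding joined_def by (metis last_snoc)
    qed
  qed
qed

text \<open>The reflection that exchanges the two layers.\<close>

definition reflect :: "'a \<times> layer \<Rightarrow> 'a \<times> layer" where
  "reflect = (\<lambda>(u, s). (u, case s of Plus \<Rightarrow> Minus | Minus \<Rightarrow> Plus))"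

lemma reflect_simps [simp]:
  "reflect (u, Plus) = (u, Minus)" "reflect (u, Minus) = (u, Plus)" "fst (reflect x) = fst x"
  "reflect (reflect x) = x"
  by (auto simp: reflect_def split: prod.splits layer.splits)

lemma reflect_bunkbed_edges: "reflect ` e \<in> bunkbed_edges V E \<longleftrightarrow> e \<in> bunkbed_edges V E"
proof -
  have imp: "reflect ` e \<in> bunkbed_edges V E" if "e \<in> bunkbed_edges V E" for e
    using that by (fastforce simp: bunkbed_edges_def insert_commute)
  show ?thesis using imp[of e] imp[of "reflect ` e"] by (auto simp: image_image)
qed

lemma reachable_reflect:
  "reachable (bunkbed_edges V E) (\<omega> \<circ> (`) reflect) x y
    \<longleftrightarrow> reachable (bunkbed_edges V E) \<omega> (reflect x) (reflect y)"
proof -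
  let ?F = "bunkbed_edges V E"
  have adj: "adjacent ?F (\<omega> \<circ> (`) reflect) a b \<longleftrightarrow> adjacent ?F \<omega> (reflect a) (reflect b)" for \<omega> a b
    using reflect_bunkbed_edges[of "{a, b}" V E] by (simp add: adjacent_def)
  have imp: "reachable ?F \<omega> (reflect x) (reflect y)" if "reachable ?F (\<omega> \<circ> (`) reflect) x y" for \<omega> x y
    using that unfolding reachable_def
    by (induction rule: rtranclp_induct) (auto simp: adj intro: rtranclp.rtrancl_into_rtrancl)
  have "\<omega> \<circ> (`) reflect \<circ> (`) reflect = \<omega>" by (simp add: fun_eq_iff image_image)
  then show ?thesis
    using imp[of \<omega> x y] imp[of "\<omega> \<circ> (`) reflect" "reflect x" "reflect y"] by auto
qed

lemma prob_reachable_reflect: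
  assumes "finite V" "simple_graph V E"
  shows "measure_pmf.prob (percolation V E pE pV) {\<omega>. reachable (bunkbed_edges V E) \<omega> (reflect x) (reflect y)}
    = measure_pmf.prob (percolation V E pE pV) {\<omega>. reachable (bunkbed_edges V E) \<omega> x y}"
proof -
  have "map_pmf (\<lambda>\<omega>. \<omega> \<circ> (`) reflect) (percolation V E pE pV) = percolation V E pE pV"
    unfolding percolation_def
    by (rule Pi_pmf_involution[OF finite_bunkbed_edges[OF assms]])
      (auto simp: image_image reflect_bunkbed_edges bunkbed_weight_def)
  then have "measure_pmf.prob (percolation V E pE pV) {\<omega>. reachable (bunkbed_edges V E) \<omega> x y}
    = measure_pmf.prob (map_pmf (\<lambda>\<omega>. \<omega> \<circ> (`) reflect) (percolation V E pE pV))
      {\<omega>. reachable (bunkbed_edges V E) \<omega> x y}" by simp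
  then show ?thesis by (simp add: vimage_def reachable_reflect)
qed

lemma bunkbed_weight_bounds:
  assumes "simple_graph V E" "\<forall>e\<in>E. pE e \<in> {0..1}" "\<forall>u\<in>V. pV u \<in> {0..1}" "e \<in> bunkbed_edges V E"
  shows "bunkbed_weight pE pV e \<in> {0..1}"
proof -
  have "u \<noteq> v" if "{u, v} \<in> E" for u v
    using that assms(1) by (auto simp: simple_graph_def doubleton_eq_iff)
  then show ?thesis
    using assms by (auto simp: bunkbed_edges_def bunkbed_weight_horizontal bunkbed_weight_vertical)
qed

theorem theorem2:
  fixes V :: "'a set" and E :: "'a set set"
    and pE :: "'a set \<Rightarrow> real" and pV :: "'a \<Rightarrow> real" and v w :: 'a
  assumes "finite V" and "complete_graph V E"
    and "\<forall>e\<in>E. pE e \<in> {0..1}" and "\<forall>u\<in>V. pV u \<in> {0..1}"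
    and "v \<in> V" and "w \<in> V"
    and "\<forall>u\<in>V - {v, w}. pE {v, u} = pE {w, u}"
  shows "measure_pmf.prob (percolation V E pE pV) {\<omega>. joined V E \<omega> (v, Minus) (w, Minus)}
       \<ge> measure_pmf.prob (percolation V E pE pV) {\<omega>. joined V E \<omega> (v, Minus) (w, Plus)}"
proof (cases "v = w")
  case True
  have simple: "simple_graph V E" using assms by (simp add: complete_graph_def)
  have "joined V E \<omega> (v, Minus) (v, Minus)" for \<omega>
    using assms by (simp add: joined_iff_reachable[OF simple] bunkbed_verts_def reachable_refl)
  then show ?thesis using True by simp
next
  case False
  have simple: "simple_graph V E" and complete: "\<And>x y. x \<in> V \<Longrightarrow> y \<in> V \<Longrightarrow> x \<noteq> y \<Longrightarrow> {x, y} \<in> E"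
    using assms by (auto simp: complete_graph_def)
  have proper: "x \<noteq> y \<and> x \<in> V \<and> y \<in> V" if "{x, y} \<in> E" for x y
    using that simple by (auto simp: simple_graph_def doubleton_eq_iff)
  let ?F = "bunkbed_edges V E"
  let ?T = "{(v, Minus), (w, Minus), (v, Plus), (w, Plus)}"
  let ?R = "(V - {v, w}) \<times> {Plus, Minus}"
  let ?p = "bunkbed_weight pE pV"
  let ?P = "\<lambda>x y. measure_pmf.prob (percolation V E pE pV) {\<omega>. reachable ?F \<omega> x y}"
  have edge_iff: "{(x, s), (u, t)} \<in> ?F \<longleftrightarrow> s = t" if "x \<in> V" "u \<in> V" "x \<noteq> u" for x u s t
    using complete[OF that] that
    by (cases s; cases t) (auto simp: bunkbed_edges_def doubleton_eq_iff insert_commute)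
  have twin: "({(v, s), z} \<in> ?F \<longleftrightarrow> {(w, s), z} \<in> ?F) \<and> ?p {(v, s), z} = ?p {(w, s), z}"
    if zR: "z \<in> ?R" for s z
  proof -
    obtain u t where z: "z = (u, t)" "u \<in> V" "u \<noteq> v" "u \<noteq> w" using zR by auto
    then have "\<not> is_singleton {v, u}" "\<not> is_singleton {w, u}" by (auto simp: is_singleton_def)
    then show ?thesis
      using z assms(5-7) edge_iff[of v u s t] edge_iff[of w u s t] by (auto simp: bunkbed_weight_def)
  qed
  have sub: "?F \<subseteq> Pow (?R \<union> ?T)"
    using proper by (auto simp: bunkbed_edges_def)
  have "?P (v, Minus) (w, Plus) + ?P (w, Minus) (v, Plus) \<le> ?P (v, Minus) (w, Minus) + ?P (v, Plus) (w, Plus)"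
    unfolding percolation_def
    using False assms(1,5,6) edge_iff[of v w Minus Plus] edge_iff[of w v Minus Plus]
    by (intro twin_pairs_connection[OF finite_bunkbed_edges[OF assms(1) simple] _ sub _ refl _
          bunkbed_weight_bounds[OF simple assms(3,4)] twin twin]) auto
  moreover have "?P (w, Minus) (v, Plus) = ?P (v, Minus) (w, Plus)"
    using prob_reachable_reflect[OF assms(1) simple, of pE pV "(v, Minus)" "(w, Plus)"]
    by (simp add: reachable_commute[of _ _ "(v, Plus)"])
  moreover have "?P (v, Plus) (w, Plus) = ?P (v, Minus) (w, Minus)"
    using prob_reachable_reflect[OF assms(1) simple, of pE pV "(v, Minus)" "(w, Minus)"] by simp
  ultimately show ?thesis
    using assms(5) by (simp add: joined_iff_reachable[OF simple] bunkbed_verts_def)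
qed

end
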